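(* Let $\Sigma$ be an alphabet and let $\mathcal{A}$ be a $\Sigma^*$-HDA. For each $n\geq 0$, the $n$th labeling cochain $\mathfrak{l}^n_{\mathcal{A}}\colon C_*(\mathcal{A})\to\Lambda(\Sigma)$ is a cocycle (of the cochain complex $C^*(\mathcal{A};\Lambda(\Sigma))=\mathrm{Hom}(C_*(\mathcal{A}),\Lambda(\Sigma))$).
   Context: Fix a principal ideal domain $R$; all modules, chain complexes and exterior algebras are over $R$. A precubical set is a graded set $P=(P_n)_{n\geq 0}$ with boundary operators $d^k_i\colon P_n\to P_{n-1}$ ($n>0$, $k\in\{0,1\}$, $1\le i\le n$) satisfying $d^k_i\circ d^l_j=d^l_{j-1}\circ d^k_i$ for $k,l\in\{0,1\}$, $i<j$. Elements of $P_n$ are the elements of degree $n$ ($n$-cubes); $0$-cubes are vertices, $1$-cubes are edges. For a monoid $M$, an $M$-HDA is a tuple $\mathcal{A}=(P_{\mathcal{A}},I_{\mathcal{A}},F_{\mathcal{A}},\lambda_{\mathcal{A}})$ where $P_{\mathcal{A}}$ is a precubical set, $I_{\mathcal{A}},F_{\mathcal{A}}\subseteq (P_{\mathcal{A}})_0$ are sets of initial and final states, and $\lambda_{\mathcal{A}}\colon (P_{\mathcal{A}})_1\to M$ is a map (labeling function) with $\lambda_{\mathcal{A}}(d^0_ix)=\lambda_{\mathcal{A}}(d^1_ix)$ for all $x\in (P_{\mathcal{A}})_2$, $i\in\{1,2\}$. One writes $\mathcal{A}$ for $P_{\mathcal{A}}$. An alphabet is a set $\Sigma$; $\Sigma^*$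 is the free monoid on $\Sigma$; $|m|$ is the length of $m\in\Sigma^*$, and $m=m_1\cdots m_{|m|}$ with $m_j\in\Sigma$. $\Lambda(\Sigma)$ is the exterior algebra on the free module generated by $\Sigma$. For $x\in P_n$, $n>0$, $k\in\{0,1\}$, $1\le i\le n$, put $e^k_ix=x$ if $n=1$ and $e^k_ix=d_1^{1-k}\cdots d_{i-1}^{1-k}d_{i+1}^{1-k}\cdots d_n^{1-k}x\in P_1$ if $n>1$. The cubical chain complex $C_*(P)$ has $C_n(P)$ the free module on $P_n$ and $dx=\sum_{i=1}^n(-1)^i(d^0_ix-d^1_ix)$ for $x\in P_n$. The $n$th labeling cochain $\mathfrak{l}^n_{\mathcal{A}}\colon C_*(\mathcal{A})\to\Lambda(\Sigma)$ is the homomorphism of degree $-n$ (vanishing outside $C_n(\mathcal{A})$, where $\Lambda(\Sigma)$ is viewed as a complex concentrated in degree $0$) given on $x\in\mathcal{A}_n$ by $\mathfrak{l}^0_{\mathcal{A}}(x)=1$ if $n=0$, and, if $n>0$, $$\mathfrak{l}^n_{\mathcal{A}}(x)=\sum_{j_1=1}^{|\lambda_{\mathcal{A}}(e^0_1x)|}\cdots\sum_{j_n=1}^{|\lambda_{\mathcal{A}}(e^0_nx)|}\lambda_{\mathcal{A}}(e^0_1x)_{j_1}\wedge\cdots\wedge\lambda_{\mathcal{A}}(e^0_nx)_{j_n}.$$ *)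

theory Defs
  imports "HOL-Algebra.Ring_Divisibility" "HOL-Algebra.QuotRing" "HOL-Algebra.Module"
begin

section \<open>Modules\<close>

text \<open>
  The fields \<^term>\<open>monoid.mult\<close> and \<^term>\<open>one\<close> of a module record carry no meaning for a
  module and are left undefined where there is no multiplication.
\<close>

definition free_module :: "('r, 'm) ring_scheme \<Rightarrow> 's set \<Rightarrow> ('r, 's \<Rightarrow> 'r) module" where
  "free_module R S =
    \<lparr>carrier = {f \<in> S \<rightarrow>\<^sub>E carrier R. finite {s \<in> S. f s \<noteq> \<zero>\<^bsub>R\<^esub>}},
     monoid.mult = undefined, one = undefined,
     ring.zero = (\<lambda>s\<in>S. \<zero>\<^bsub>R\<^esub>),
     add = (\<lambda>f g. \<lambda>s\<in>S. f s \<oplus>\<^bsub>R\<^esub> g s),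
     smult = (\<lambda>r f. \<lambda>s\<in>S. r \<otimes>\<^bsub>R\<^esub> f s)\<rparr>"

definition free_gen :: "('r, 'm) ring_scheme \<Rightarrow> 's set \<Rightarrow> 's \<Rightarrow> 's \<Rightarrow> 'r" where
  "free_gen R S s = (\<lambda>t\<in>S. if t = s then \<one>\<^bsub>R\<^esub> else \<zero>\<^bsub>R\<^esub>)"

text \<open>The linear map from the free module on \<open>S\<close> to \<open>N\<close> with prescribed values \<open>g\<close> on the basis.\<close>

definition linear_extension ::
    "('r, 'm) ring_scheme \<Rightarrow> 's set \<Rightarrow> ('r, 'b, 'z) module_scheme \<Rightarrow> ('s \<Rightarrow> 'b) \<Rightarrow> ('s \<Rightarrow> 'r) \<Rightarrow> 'b"
  where
  "linear_extension R S N g =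
    (\<lambda>f\<in>carrier (free_module R S). \<Oplus>\<^bsub>N\<^esub>s\<in>{s \<in> S. f s \<noteq> \<zero>\<^bsub>R\<^esub>}. f s \<odot>\<^bsub>N\<^esub> g s)"

definition hom_module ::
    "('r, 'm) ring_scheme \<Rightarrow> ('r, 'a, 'y) module_scheme \<Rightarrow> ('r, 'b, 'z) module_scheme
      \<Rightarrow> ('r, 'a \<Rightarrow> 'b) module"
  where
  "hom_module R M N =
    \<lparr>carrier = {f \<in> carrier M \<rightarrow>\<^sub>E carrier N.
       (\<forall>x\<in>carrier M. \<forall>y\<in>carrier M. f (x \<oplus>\<^bsub>M\<^esub> y) = f x \<oplus>\<^bsub>N\<^esub> f y) \<and>
       (\<forall>r\<in>carrier R. \<forall>x\<in>carrier M. f (r \<odot>\<^bsub>M\<^esub> x) = r \<odot>\<^bsub>N\<^esub> f x)},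
     monoid.mult = undefined, one = undefined,
     ring.zero = (\<lambda>x\<in>carrier M. \<zero>\<^bsub>N\<^esub>),
     add = (\<lambda>f g. \<lambda>x\<in>carrier M. f x \<oplus>\<^bsub>N\<^esub> g x),
     smult = (\<lambda>r f. \<lambda>x\<in>carrier M. r \<odot>\<^bsub>N\<^esub> f x)\<rparr>"

section \<open>The exterior algebra of a module\<close>

text \<open>The algebra of noncommutative polynomials with variables in \<open>X\<close>.\<close>

definition free_algebra :: "('r, 'm) ring_scheme \<Rightarrow> 'x set \<Rightarrow> ('r, 'x list \<Rightarrow> 'r) module" where
  "free_algebra R X = (free_module R (lists X))
    \<lparr>monoid.mult := (\<lambda>f g. \<lambda>w\<in>lists X. \<Oplus>\<^bsub>R\<^esub>i\<in>{..length w}. f (take i w) \<otimes>\<^bsub>R\<^esub> g (drop i w)),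
     one := free_gen R (lists X) []\<rparr>"

definition free_var :: "('r, 'm) ring_scheme \<Rightarrow> 'x set \<Rightarrow> 'x \<Rightarrow> 'x list \<Rightarrow> 'r" where
  "free_var R X x = free_gen R (lists X) [x]"

text \<open>
  The exterior algebra of \<open>M\<close> is the tensor algebra of \<open>M\<close> modulo the squares of elements of
  \<open>M\<close>. The tensor algebra in turn is the free algebra on the set \<^term>\<open>carrier M\<close> modulo
  the relations making \<open>x \<mapsto> [x]\<close> linear; here both quotients are taken at once.
\<close>

definition exterior_relations ::
    "('r, 'm) ring_scheme \<Rightarrow> ('r, 'a, 'z) module_scheme \<Rightarrow> ('a list \<Rightarrow> 'r) set"
  where
  "exterior_relations R M =
    (let T = free_algebra R (carrier M); v = free_var R (carrier M) in
       {v (x \<oplus>\<^bsub>M\<^esub> y) \<ominus>\<^bsub>T\<^esub> (v x \<oplus>\<^bsub>T\<^esub> v y) | x y. x \<in> carrier M \<and> y \<in> carrier M} \<union>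
       {v (r \<odot>\<^bsub>M\<^esub> x) \<ominus>\<^bsub>T\<^esub> (r \<odot>\<^bsub>T\<^esub> v x) | r x. r \<in> carrier R \<and> x \<in> carrier M} \<union>
       {v x \<otimes>\<^bsub>T\<^esub> v x | x. x \<in> carrier M})"

definition exterior_ideal ::
    "('r, 'm) ring_scheme \<Rightarrow> ('r, 'a, 'z) module_scheme \<Rightarrow> ('a list \<Rightarrow> 'r) set"
  where
  "exterior_ideal R M = Idl\<^bsub>free_algebra R (carrier M)\<^esub> (exterior_relations R M)"

definition exterior_algebra ::
    "('r, 'm) ring_scheme \<Rightarrow> ('r, 'a, 'z) module_scheme \<Rightarrow> ('r, ('a list \<Rightarrow> 'r) set) module"
  where
  "exterior_algebra R M =
    (let T = free_algebra R (carrier M); J = exterior_ideal R M in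
       ring.extend (T Quot J) (module.fields (\<lambda>r C. \<Union>c\<in>C. J +>\<^bsub>T\<^esub> (r \<odot>\<^bsub>T\<^esub> c))))"

definition exterior_incl ::
    "('r, 'm) ring_scheme \<Rightarrow> ('r, 'a, 'z) module_scheme \<Rightarrow> 'a \<Rightarrow> ('a list \<Rightarrow> 'r) set"
  where
  "exterior_incl R M x =
    exterior_ideal R M +>\<^bsub>free_algebra R (carrier M)\<^esub> free_var R (carrier M) x"

section \<open>Precubical sets\<close>

text \<open>\<open>bnd P n k i\<close> is the boundary operator \<open>d\<^sup>k\<^sub>i\<close> from degree \<open>n\<close> to degree \<open>n - 1\<close>.\<close>

record 'p precubical =
  cubes :: "nat \<Rightarrow> 'p set"
  bnd :: "nat \<Rightarrow> nat \<Rightarrow> nat \<Rightarrow> 'p \<Rightarrow> 'p"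

locale precubical_set =
  fixes P :: "('p, 'z) precubical_scheme"
  assumes bnd_closed:
      "\<lbrakk>n > 0; k \<in> {0, 1}; i \<in> {1..n}; x \<in> cubes P n\<rbrakk> \<Longrightarrow> bnd P n k i x \<in> cubes P (n - 1)"
    and bnd_bnd:
      "\<lbrakk>k \<in> {0, 1}; l \<in> {0, 1}; 1 \<le> i; i < j; j \<le> n; x \<in> cubes P n\<rbrakk> \<Longrightarrow>
        bnd P (n - 1) k i (bnd P n l j x) = bnd P (n - 1) l (j - 1) (bnd P n k i x)"

text \<open>
  \<open>bnds P n k [i\<^sub>1, \<dots>, i\<^sub>m]\<close> is the composite of \<open>d\<^sup>k\<close> with indices \<open>i\<^sub>1, \<dots>, i\<^sub>m\<close> written from
  left to right, so the operator with index \<open>i\<^sub>m\<close> acts first, on cubes of degree \<open>n\<close>.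
\<close>

primrec bnds :: "('p, 'z) precubical_scheme \<Rightarrow> nat \<Rightarrow> nat \<Rightarrow> nat list \<Rightarrow> 'p \<Rightarrow> 'p" where
  "bnds P n k [] x = x"
| "bnds P n k (i # is) x = bnd P (n - length is) k i (bnds P n k is x)"

definition edge :: "('p, 'z) precubical_scheme \<Rightarrow> nat \<Rightarrow> nat \<Rightarrow> nat \<Rightarrow> 'p \<Rightarrow> 'p" where
  "edge P n k i x = (if n = 1 then x else bnds P n (1 - k) ([1..<i] @ [i + 1..<n + 1]) x)"

section \<open>Higher-dimensional automata\<close>

record ('p, 'a) hda = "'p precubical" +
  initial :: "'p set"
  final :: "'p set"
  label :: "'p \<Rightarrow> 'a"

locale hda = monoid M + precubical_set A
  for M :: "('a, 'y) monoid_scheme" and A :: "('p, 'a, 'z) hda_scheme" +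
  assumes initial_subset: "initial A \<subseteq> cubes A 0"
    and final_subset: "final A \<subseteq> cubes A 0"
    and label_closed: "x \<in> cubes A 1 \<Longrightarrow> label A x \<in> carrier M"
    and label_bnd:
      "\<lbrakk>x \<in> cubes A 2; i \<in> {1, 2}\<rbrakk> \<Longrightarrow> label A (bnd A 2 0 i x) = label A (bnd A 2 1 i x)"

definition free_monoid :: "'s set \<Rightarrow> 's list monoid" where
  "free_monoid S = \<lparr>carrier = lists S, monoid.mult = (@), one = []\<rparr>"

section \<open>Cubical chains and cochains\<close>

definition cubical_chains ::
    "('r, 'm) ring_scheme \<Rightarrow> ('p, 'z) precubical_scheme \<Rightarrow> nat \<Rightarrow> ('r, 'p \<Rightarrow> 'r) module"
  where
  "cubical_chains R P n = free_module R (cubes P n)"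

text \<open>The differential from degree \<open>n\<close> to degree \<open>n - 1\<close>, for \<open>n > 0\<close>.\<close>

definition cubical_diff ::
    "('r, 'm) ring_scheme \<Rightarrow> ('p, 'z) precubical_scheme \<Rightarrow> nat \<Rightarrow> ('p \<Rightarrow> 'r) \<Rightarrow> 'p \<Rightarrow> 'r"
  where
  "cubical_diff R P n =
    (let C = cubical_chains R P (n - 1); b = free_gen R (cubes P (n - 1)) in
       linear_extension R (cubes P n) C
         (\<lambda>x. \<Oplus>\<^bsub>C\<^esub>i\<in>{1..n}.
            ((\<ominus>\<^bsub>R\<^esub> \<one>\<^bsub>R\<^esub>) [^]\<^bsub>R\<^esub> i) \<odot>\<^bsub>C\<^esub> (b (bnd P n 0 i x) \<ominus>\<^bsub>C\<^esub> b (bnd P n 1 i x))))"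

text \<open>
  With coefficients in a module \<open>N\<close> concentrated in degree \<open>0\<close>, a homomorphism of degree \<open>-n\<close>
  from the cubical chain complex vanishes on all chains of degree other than \<open>n\<close>, so that it
  is the same as a linear map from the chains of degree \<open>n\<close> to \<open>N\<close>.
\<close>

definition cochains ::
    "('r, 'm) ring_scheme \<Rightarrow> ('p, 'z) precubical_scheme \<Rightarrow> ('r, 'b, 'y) module_scheme \<Rightarrow> nat
      \<Rightarrow> ('r, ('p \<Rightarrow> 'r) \<Rightarrow> 'b) module"
  where
  "cochains R P N n = hom_module R (cubical_chains R P n) N"

text \<open>
  The coboundary from degree \<open>n\<close> to degree \<open>n + 1\<close>. Some authors insert the sign
  \<open>(-1)\<^bsup>n+1\<^esup>\<close>, which does not affect the cocycles.
\<close>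

definition coboundary ::
    "('r, 'm) ring_scheme \<Rightarrow> ('p, 'z) precubical_scheme \<Rightarrow> nat \<Rightarrow> (('p \<Rightarrow> 'r) \<Rightarrow> 'b)
      \<Rightarrow> ('p \<Rightarrow> 'r) \<Rightarrow> 'b"
  where
  "coboundary R P n f =
    (\<lambda>c\<in>carrier (cubical_chains R P (n + 1)). f (cubical_diff R P (n + 1) c))"

definition cocycles ::
    "('r, 'm) ring_scheme \<Rightarrow> ('p, 'z) precubical_scheme \<Rightarrow> ('r, 'b, 'y) module_scheme \<Rightarrow> nat
      \<Rightarrow> (('p \<Rightarrow> 'r) \<Rightarrow> 'b) set"
  where
  "cocycles R P N n =
    {f \<in> carrier (cochains R P N n). coboundary R P n f = \<zero>\<^bsub>cochains R P N (n + 1)\<^esub>}"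

section \<open>Labeling cochains\<close>

definition alphabet_algebra ::
    "('r, 'm) ring_scheme \<Rightarrow> 's set \<Rightarrow> ('r, (('s \<Rightarrow> 'r) list \<Rightarrow> 'r) set) module"
  where
  "alphabet_algebra R S = exterior_algebra R (free_module R S)"

definition letter ::
    "('r, 'm) ring_scheme \<Rightarrow> 's set \<Rightarrow> 's \<Rightarrow> (('s \<Rightarrow> 'r) list \<Rightarrow> 'r) set"
  where
  "letter R S a = exterior_incl R (free_module R S) (free_gen R S a)"

text \<open>
  The iterated sum over \<open>j\<^sub>1, \<dots>, j\<^sub>n\<close> is written as one sum over the index tuples \<open>j\<close>.
  Positions in words start at \<open>1\<close>, whereas \<^term>\<open>(!)\<close> counts from \<open>0\<close>.
\<close>

definition labeling_value ::
    "('r, 'm) ring_scheme \<Rightarrow> 's set \<Rightarrow> ('p, 's list, 'z) hda_scheme \<Rightarrow> nat \<Rightarrow> 'p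
      \<Rightarrow> (('s \<Rightarrow> 'r) list \<Rightarrow> 'r) set"
  where
  "labeling_value R S A n x =
    (let L = alphabet_algebra R S; w = (\<lambda>i. label A (edge A n 0 i x)) in
       if n = 0 then \<one>\<^bsub>L\<^esub>
       else \<Oplus>\<^bsub>L\<^esub>j\<in>(\<Pi>\<^sub>E i\<in>{1..n}. {1..length (w i)}).
         foldr (\<otimes>\<^bsub>L\<^esub>) (map (\<lambda>i. letter R S (w i ! (j i - 1))) [1..<n + 1]) \<one>\<^bsub>L\<^esub>)"

definition labeling_cochain ::
    "('r, 'm) ring_scheme \<Rightarrow> 's set \<Rightarrow> ('p, 's list, 'z) hda_scheme \<Rightarrow> nat
      \<Rightarrow> ('p \<Rightarrow> 'r) \<Rightarrow> (('s \<Rightarrow> 'r) list \<Rightarrow> 'r) set"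
  where
  "labeling_cochain R S A n =
    linear_extension R (cubes A n) (alphabet_algebra R S) (labeling_value R S A n)"

end

theory Submission
  imports Defs
begin

text \<open>
  By the cubical identities, the edge \<open>e\<^sup>0\<^sub>j (d\<^sup>k\<^sub>i x)\<close> is of the form \<open>d\<^sup>k\<^sub>i\<^sub>' z\<close> for a 2-cube \<open>z\<close> and
  an index \<open>i'\<close> that do not depend on \<open>k\<close>. As the labels of opposite edges of a 2-cube agree, all
  labels entering the value of the labeling cochain on \<open>d\<^sup>k\<^sub>i x\<close> are independent of \<open>k\<close>, so the
  terms of the coboundary cancel in pairs. No relation of the exterior algebra is needed,
  only that it is a ring and a module.
\<close>

section \<open>Free modules and linear extensions\<close>

lemma free_module_simps [simp]:
  "\<zero>\<^bsub>free_module R S\<^esub> = (\<lambda>s\<in>S. \<zero>\<^bsub>R\<^esub>)"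
  "f \<oplus>\<^bsub>free_module R S\<^esub> g = (\<lambda>s\<in>S. f s \<oplus>\<^bsub>R\<^esub> g s)"
  "r \<odot>\<^bsub>free_module R S\<^esub> f = (\<lambda>s\<in>S. r \<otimes>\<^bsub>R\<^esub> f s)"
  by (simp_all add: free_module_def)

lemma free_module_carrier:
  "f \<in> carrier (free_module R S) \<longleftrightarrow>
    f \<in> S \<rightarrow>\<^sub>E carrier R \<and> finite {s \<in> S. f s \<noteq> \<zero>\<^bsub>R\<^esub>}"
  by (simp add: free_module_def)

lemma free_module_closed: "\<lbrakk>f \<in> carrier (free_module R S); s \<in> S\<rbrakk> \<Longrightarrow> f s \<in> carrier R"
  by (auto simp: free_module_carrier)

lemma free_module_eqI:
  assumes "f \<in> carrier (free_module R S)" "g \<in> carrier (free_module R S)"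
    and "\<And>s. s \<in> S \<Longrightarrow> f s = g s"
  shows "f = g"
  using assms by (auto simp: free_module_carrier intro: PiE_ext)

text \<open>A finite superset \<open>B\<close> of the support is easier to name than the support
  itself, which may shrink through cancellation in sums, multiples and products.\<close>

lemma (in cring) free_module_memI:
  assumes "\<And>s. s \<in> S \<Longrightarrow> f s \<in> carrier R"
    and "finite B" "\<And>s. \<lbrakk>s \<in> S; s \<notin> B\<rbrakk> \<Longrightarrow> f s = \<zero>"
  shows "(\<lambda>s\<in>S. f s) \<in> carrier (free_module R S)"
proof -
  have "{s \<in> S. (\<lambda>s\<in>S. f s) s \<noteq> \<zero>} \<subseteq> B"
    using assms(3) by auto
  with \<open>finite B\<close> show ?thesis
    using assms(1) by (simp add: free_module_carrier restrict_PiE finite_subset del: restrict_apply)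
qed

lemma (in cring) free_gen_closed [simp]: "free_gen R S s \<in> carrier (free_module R S)"
  unfolding free_gen_def by (rule free_module_memI[where B = "{s}"]) auto

lemma (in cring) free_module_add_closed:
  assumes "f \<in> carrier (free_module R S)" "g \<in> carrier (free_module R S)"
  shows "(\<lambda>s\<in>S. f s \<oplus> g s) \<in> carrier (free_module R S)"
  by (rule free_module_memI[where B = "{s \<in> S. f s \<noteq> \<zero>} \<union> {s \<in> S. g s \<noteq> \<zero>}"])
    (use assms in \<open>auto simp: free_module_carrier\<close>)

lemma (in cring) free_module_smult_closed:
  assumes "r \<in> carrier R" "f \<in> carrier (free_module R S)"
  shows "(\<lambda>s\<in>S. r \<otimes> f s) \<in> carrier (free_module R S)"
  by (rule free_module_memI[where B = "{s \<in> S. f s \<noteq> \<zero>}"])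
    (use assms in \<open>auto simp: free_module_carrier\<close>)

lemma (in cring) free_module_zero_closed: "(\<lambda>s\<in>S. \<zero>) \<in> carrier (free_module R S)"
  by (rule free_module_memI[where B = "{}"]) auto

lemmas (in cring) free_module_closed_intros =
  free_module_add_closed free_module_smult_closed free_module_zero_closed

lemma (in cring) free_module_abelian_group: "abelian_group (free_module R S)"
proof (rule abelian_groupI)
  fix f assume f: "f \<in> carrier (free_module R S)"
  \<comment> \<open>The additive inverse is taken to be the scalar multiple by
    \<open>\<ominus> \<one>\<close>, so that its closure is an instance of closure under
    scalars.\<close>
  have "(\<lambda>s\<in>S. (\<ominus> \<one>) \<otimes> f s) \<oplus>\<^bsub>free_module R S\<^esub> f = \<zero>\<^bsub>free_module R S\<^esub>"
    using f by (intro free_module_eqI[where R = R and S = S])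
      (auto simp: free_module_closed l_minus l_neg simp del: restrict_apply
        intro!: free_module_add_closed free_module_smult_closed free_module_zero_closed, auto simp: free_module_closed l_minus l_neg)
  moreover have "(\<lambda>s\<in>S. (\<ominus> \<one>) \<otimes> f s) \<in> carrier (free_module R S)"
    using f by (intro free_module_closed_intros) auto
  ultimately show "\<exists>g\<in>carrier (free_module R S). g \<oplus>\<^bsub>free_module R S\<^esub> f = \<zero>\<^bsub>free_module R S\<^esub>"
    by blast
  show "\<zero>\<^bsub>free_module R S\<^esub> \<oplus>\<^bsub>free_module R S\<^esub> f = f"
    unfolding free_module_simps
    by (rule free_module_eqI[where R = R and S = S,
          OF free_module_add_closed[OF free_module_zero_closed f] f])
      (use f in \<open>simp add: free_module_closed\<close>)
qed (auto simp: free_module_closed a_ac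
    intro!: free_module_closed_intros free_module_eqI[where R = R and S = S] restrict_ext)

lemma (in cring) free_module_module: "module R (free_module R S)"
  by (rule moduleI)
    (auto simp: free_module_closed is_cring free_module_abelian_group l_distr r_distr m_ac
      intro!: free_module_closed_intros free_module_eqI[where R = R and S = S] restrict_ext)

section \<open>Linear maps out of a free module, given on the basis\<close>

context module
begin

text \<open>The defining sum runs over the support of \<open>f\<close>, which varies with
  \<open>f\<close>. Padding it with zero terms allows several elements to be evaluated over one
  common finite index set, as additivity requires.\<close>

lemma linear_extension_superset:
  assumes f: "f \<in> carrier (free_module R S)" and g: "g \<in> S \<rightarrow> carrier M"
    and B: "finite B" "{s \<in> S. f s \<noteq> \<zero>} \<subseteq> B" "B \<subseteq> S"
  shows "linear_extension R S M g f = (\<Oplus>\<^bsub>M\<^esub>s\<in>B. f s \<odot>\<^bsub>M\<^esub> g s)"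
proof -
  have "(\<Oplus>\<^bsub>M\<^esub>s\<in>{s \<in> S. f s \<noteq> \<zero>}. f s \<odot>\<^bsub>M\<^esub> g s) = (\<Oplus>\<^bsub>M\<^esub>s\<in>B. f s \<odot>\<^bsub>M\<^esub> g s)"
  proof (rule M.add.finprod_mono_neutral_cong_left[OF B(1,2)])
    fix s assume "s \<in> B - {s \<in> S. f s \<noteq> \<zero>}"
    then have "s \<in> S" "f s = \<zero>" using B by auto
    then show "f s \<odot>\<^bsub>M\<^esub> g s = \<zero>\<^bsub>M\<^esub>"
      using g by (simp add: Pi_iff)
  next
    show "(\<lambda>s. f s \<odot>\<^bsub>M\<^esub> g s) \<in> B \<rightarrow> carrier M"
      using B(3) f g by (auto simp: free_module_closed intro!: smult_closed)
  qed simp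
  then show ?thesis
    using f by (simp add: linear_extension_def)
qed

lemma linear_extension_closed:
  assumes f: "f \<in> carrier (free_module R S)" and g: "g \<in> S \<rightarrow> carrier M"
  shows "linear_extension R S M g f \<in> carrier M"
  using assms by (auto simp: linear_extension_def free_module_closed intro!: M.finsum_closed)

lemma linear_extension_free_gen:
  assumes g: "g \<in> S \<rightarrow> carrier M" and s: "s \<in> S"
  shows "linear_extension R S M g (free_gen R S s) = g s"
proof -
  have "linear_extension R S M g (free_gen R S s) = (\<Oplus>\<^bsub>M\<^esub>t\<in>{s}. free_gen R S s t \<odot>\<^bsub>M\<^esub> g t)"
    using s by (intro linear_extension_superset R.free_gen_closed g) (auto simp: free_gen_def)
  also have "\<dots> = g s"
    using g s by (auto simp: free_gen_def Pi_iff)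
  finally show ?thesis .
qed

lemma linear_extension_add:
  assumes f: "f \<in> carrier (free_module R S)" "f' \<in> carrier (free_module R S)"
    and g: "g \<in> S \<rightarrow> carrier M"
  shows "linear_extension R S M g (f \<oplus>\<^bsub>free_module R S\<^esub> f') =
    linear_extension R S M g f \<oplus>\<^bsub>M\<^esub> linear_extension R S M g f'"
proof -
  let ?B = "{s \<in> S. f s \<noteq> \<zero>} \<union> {s \<in> S. f' s \<noteq> \<zero>}"
  have B: "finite ?B" using f by (auto simp: free_module_carrier)
  have *: "linear_extension R S M g h = (\<Oplus>\<^bsub>M\<^esub>s\<in>?B. h s \<odot>\<^bsub>M\<^esub> g s)"
    if "h \<in> carrier (free_module R S)" "{s \<in> S. h s \<noteq> \<zero>} \<subseteq> ?B" for h
    by (rule linear_extension_superset[OF that(1) g B that(2)]) auto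
  have "linear_extension R S M g (f \<oplus>\<^bsub>free_module R S\<^esub> f') =
      (\<Oplus>\<^bsub>M\<^esub>s\<in>?B. (f \<oplus>\<^bsub>free_module R S\<^esub> f') s \<odot>\<^bsub>M\<^esub> g s)"
    using f by (intro *) (auto intro: R.free_module_closed_intros)
  also have "\<dots> = (\<Oplus>\<^bsub>M\<^esub>s\<in>?B. f s \<odot>\<^bsub>M\<^esub> g s \<oplus>\<^bsub>M\<^esub> f' s \<odot>\<^bsub>M\<^esub> g s)"
    using f g by (intro M.finsum_cong')
      (auto simp: free_module_closed Pi_iff intro!: smult_l_distr)
  also have "\<dots> = linear_extension R S M g f \<oplus>\<^bsub>M\<^esub> linear_extension R S M g f'"
    using f g by (subst M.finsum_addf) (auto simp: free_module_closed * Pi_iff)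
  finally show ?thesis .
qed

lemma linear_extension_smult:
  assumes r: "r \<in> carrier R" and f: "f \<in> carrier (free_module R S)"
    and g: "g \<in> S \<rightarrow> carrier M"
  shows "linear_extension R S M g (r \<odot>\<^bsub>free_module R S\<^esub> f) = r \<odot>\<^bsub>M\<^esub> linear_extension R S M g f"
proof -
  let ?B = "{s \<in> S. f s \<noteq> \<zero>}"
  have B: "finite ?B" using f by (auto simp: free_module_carrier)
  have "linear_extension R S M g (r \<odot>\<^bsub>free_module R S\<^esub> f) =
      (\<Oplus>\<^bsub>M\<^esub>s\<in>?B. (r \<odot>\<^bsub>free_module R S\<^esub> f) s \<odot>\<^bsub>M\<^esub> g s)"
    using r f B by (intro linear_extension_superset g) (auto intro: R.free_module_closed_intros)
  also have "\<dots> = (\<Oplus>\<^bsub>M\<^esub>s\<in>?B. r \<odot>\<^bsub>M\<^esub> (f s \<odot>\<^bsub>M\<^esub> g s))"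
    using r f g by (intro M.finsum_cong')
      (auto simp: free_module_closed Pi_iff intro!: smult_assoc1)
  also have "\<dots> = r \<odot>\<^bsub>M\<^esub> (\<Oplus>\<^bsub>M\<^esub>s\<in>?B. f s \<odot>\<^bsub>M\<^esub> g s)"
    using r f g B by (intro finsum_smult_ldistr[symmetric]) (auto simp: free_module_closed Pi_iff)
  also have "\<dots> = r \<odot>\<^bsub>M\<^esub> linear_extension R S M g f"
    using f by (simp add: linear_extension_def)
  finally show ?thesis .
qed

lemma linear_extension_hom:
  assumes "g \<in> S \<rightarrow> carrier M"
  shows "linear_extension R S M g \<in> carrier (hom_module R (free_module R S) M)"
proof -
  have "linear_extension R S M g \<in> carrier (free_module R S) \<rightarrow>\<^sub>E carrier M"
  proof (rule PiE_I)
    fix f assume "f \<notin> carrier (free_module R S)"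
    then show "linear_extension R S M g f = undefined" by (simp add: linear_extension_def)
  qed (rule linear_extension_closed[OF _ assms])
  then show ?thesis
    using linear_extension_add[OF _ _ assms] linear_extension_smult[OF _ _ assms]
    by (simp add: hom_module_def)
qed

end

section \<open>Linear maps between two modules\<close>

locale module_morphism = M?: module R M + N?: module R N
  for R (structure) and M (structure) and N (structure) +
  fixes h
  assumes hom: "h \<in> carrier (hom_module R M N)"
begin

lemma hom_closed [simp]: "x \<in> carrier M \<Longrightarrow> h x \<in> carrier N"
  using hom by (auto simp: hom_module_def)

lemma hom_add [simp]:
  "\<lbrakk>x \<in> carrier M; y \<in> carrier M\<rbrakk> \<Longrightarrow> h (x \<oplus>\<^bsub>M\<^esub> y) = h x \<oplus>\<^bsub>N\<^esub> h y"
  using hom by (auto simp: hom_module_def)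

lemma hom_smult [simp]:
  "\<lbrakk>r \<in> carrier R; x \<in> carrier M\<rbrakk> \<Longrightarrow> h (r \<odot>\<^bsub>M\<^esub> x) = r \<odot>\<^bsub>N\<^esub> h x"
  using hom by (auto simp: hom_module_def)

lemma hom_zero [simp]: "h \<zero>\<^bsub>M\<^esub> = \<zero>\<^bsub>N\<^esub>"
  \<comment> \<open>The zero vector is the scalar zero times itself, so preservation of scalar
    multiples already gives the claim.\<close>
  using hom_smult[of "\<zero>" "\<zero>\<^bsub>M\<^esub>"] by simp

lemma hom_minus:
  assumes "x \<in> carrier M" "y \<in> carrier M"
  shows "h (x \<ominus>\<^bsub>M\<^esub> y) = h x \<ominus>\<^bsub>N\<^esub> h y"
proof -
  have "\<ominus>\<^bsub>M\<^esub> y = (\<ominus> \<one>) \<odot>\<^bsub>M\<^esub> y" "\<ominus>\<^bsub>N\<^esub> h y = (\<ominus> \<one>) \<odot>\<^bsub>N\<^esub> h y"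
    using assms by (simp_all add: M.smult_l_minus N.smult_l_minus)
  then show ?thesis
    using assms by (simp add: a_minus_def)
qed

text \<open>Induction on \<open>I\<close>. For infinite \<open>I\<close> the sum is zero by
  convention, so that case reduces to \<open>hom_zero\<close>.\<close>

lemma hom_finsum_eq_zero:
  assumes "\<And>i. i \<in> I \<Longrightarrow> f i \<in> carrier M" "\<And>i. i \<in> I \<Longrightarrow> h (f i) = \<zero>\<^bsub>N\<^esub>"
  shows "h (\<Oplus>\<^bsub>M\<^esub>i\<in>I. f i) = \<zero>\<^bsub>N\<^esub>"
  using assms by (induction I rule: infinite_finite_induct) (auto simp: Pi_iff)

lemma hom_linear_extension_eq_zero:
  assumes "f \<in> carrier (free_module R S)"
    and "\<And>s. s \<in> S \<Longrightarrow> g s \<in> carrier M" "\<And>s. s \<in> S \<Longrightarrow> h (g s) = \<zero>\<^bsub>N\<^esub>"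
  shows "h (linear_extension R S M g f) = \<zero>\<^bsub>N\<^esub>"
  using assms by (auto simp: linear_extension_def free_module_closed intro!: hom_finsum_eq_zero)

end

section \<open>The free algebra\<close>

text \<open>This is the product of noncommutative polynomials without the restriction to
  \<open>lists X\<close>. It mentions no variable set, and its laws can be proved one word at a
  time.\<close>

definition conv :: "('r, 'm) ring_scheme \<Rightarrow> ('x list \<Rightarrow> 'r) \<Rightarrow> ('x list \<Rightarrow> 'r) \<Rightarrow> 'x list \<Rightarrow> 'r" where
  "conv R f g w = (\<Oplus>\<^bsub>R\<^esub>i\<in>{..length w}. f (take i w) \<otimes>\<^bsub>R\<^esub> g (drop i w))"

context cring
begin

lemma take_drop_lists:
  assumes "w \<in> lists X"
  shows "take i w \<in> lists X" "drop i w \<in> lists X"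
  using assms by (auto dest: in_set_takeD in_set_dropD)

text \<open>Membership in \<open>lists X\<close> should stay whole, in the form in which the
  function-space hypotheses consume it, instead of being split into conditions on single
  letters.\<close>

declare in_listsI [rule del] in_listsD [rule del]

lemma conv_closed:
  assumes "f \<in> lists X \<rightarrow> carrier R" "g \<in> lists X \<rightarrow> carrier R" "w \<in> lists X"
  shows "conv R f g w \<in> carrier R"
  unfolding conv_def using assms take_drop_lists[OF assms(3)]
  by (intro finsum_closed Pi_I m_closed) (auto simp: Pi_iff)

lemma conv_funcset:
  assumes "f \<in> lists X \<rightarrow> carrier R" "g \<in> lists X \<rightarrow> carrier R"
  shows "conv R f g \<in> lists X \<rightarrow> carrier R"
  by (rule Pi_I) (rule conv_closed[OF assms])

lemma conv_cong:
  assumes "f \<in> lists X \<rightarrow> carrier R" "g \<in> lists X \<rightarrow> carrier R" "w \<in> lists X"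
    and "\<And>v. v \<in> lists X \<Longrightarrow> f' v = f v" "\<And>v. v \<in> lists X \<Longrightarrow> g' v = g v"
  shows "conv R f' g' w = conv R f g w"
  unfolding conv_def using assms take_drop_lists[OF assms(3)]
  by (intro finsum_cong') (auto simp: Pi_iff)

lemma conv_Nil:
  assumes "f \<in> lists X \<rightarrow> carrier R" "g \<in> lists X \<rightarrow> carrier R"
  shows "conv R f g [] = f [] \<otimes> g []"
  using assms by (auto simp: conv_def Pi_iff)

text \<open>Among the ways to cut \<open>x # w\<close> in two, one has an empty prefix. In all
  others the prefix begins with \<open>x\<close>, and they correspond to the cuts of
  \<open>w\<close> with \<open>f\<close> replaced by its left shift
  \<open>\<lambda>v. f (x # v)\<close>. This recursion replaces the manipulation of double sums
  below.\<close>

lemma conv_Cons: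
  assumes f: "f \<in> lists X \<rightarrow> carrier R" and g: "g \<in> lists X \<rightarrow> carrier R"
    and w: "x \<in> X" "w \<in> lists X"
  shows "conv R f g (x # w) = f [] \<otimes> g (x # w) \<oplus> conv R (\<lambda>v. f (x # v)) g w"
proof -
  have xw: "x # w \<in> lists X" using w by simp
  have *: "(\<lambda>i. f (take i (x # w)) \<otimes> g (drop i (x # w))) \<in> {..Suc (length w)} \<rightarrow> carrier R"
    using f g take_drop_lists[OF xw] by (auto simp del: Cons_in_lists_iff in_lists_conv_set simp: Pi_iff)
  \<comment> \<open>\<open>finsum_Suc2\<close> splits off the term of index 0 but puts it last,
    hence the final use of commutativity.\<close>
  have "conv R f g (x # w) = conv R (\<lambda>v. f (x # v)) g w \<oplus> f [] \<otimes> g (x # w)"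
    unfolding conv_def using finsum_Suc2[OF *] by simp
  moreover have "conv R (\<lambda>v. f (x # v)) g w \<in> carrier R"
    using f g w by (intro conv_closed[where X = X]) (auto simp: Pi_iff)
  moreover have "f [] \<otimes> g (x # w) \<in> carrier R"
    using f g xw by (auto simp: Pi_iff)
  ultimately show ?thesis by (simp add: a_comm)
qed

lemma conv_add_left:
  assumes f: "f \<in> lists X \<rightarrow> carrier R" "f' \<in> lists X \<rightarrow> carrier R"
    and g: "g \<in> lists X \<rightarrow> carrier R" and w: "w \<in> lists X"
  shows "conv R (\<lambda>v. f v \<oplus> f' v) g w = conv R f g w \<oplus> conv R f' g w"
proof -
  note tw = take_drop_lists[OF w]
  have "conv R (\<lambda>v. f v \<oplus> f' v) g w =
      (\<Oplus>i\<in>{..length w}. f (take i w) \<otimes> g (drop i w) \<oplus> f' (take i w) \<otimes> g (drop i w))"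
    unfolding conv_def using f g tw
    by (intro finsum_cong') (auto simp: Pi_iff intro!: l_distr)
  also have "\<dots> = conv R f g w \<oplus> conv R f' g w"
    unfolding conv_def using f g tw by (intro finsum_addf) (auto simp: Pi_iff)
  finally show ?thesis .
qed

lemma conv_add_right:
  assumes f: "f \<in> lists X \<rightarrow> carrier R"
    and g: "g \<in> lists X \<rightarrow> carrier R" "g' \<in> lists X \<rightarrow> carrier R" and w: "w \<in> lists X"
  shows "conv R f (\<lambda>v. g v \<oplus> g' v) w = conv R f g w \<oplus> conv R f g' w"
proof -
  note tw = take_drop_lists[OF w]
  have "conv R f (\<lambda>v. g v \<oplus> g' v) w =
      (\<Oplus>i\<in>{..length w}. f (take i w) \<otimes> g (drop i w) \<oplus> f (take i w) \<otimes> g' (drop i w))"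
    unfolding conv_def using f g tw
    by (intro finsum_cong') (auto simp: Pi_iff intro!: r_distr)
  also have "\<dots> = conv R f g w \<oplus> conv R f g' w"
    unfolding conv_def using f g tw by (intro finsum_addf) (auto simp: Pi_iff)
  finally show ?thesis .
qed

lemma conv_smult_left:
  assumes r: "r \<in> carrier R" and f: "f \<in> lists X \<rightarrow> carrier R"
    and g: "g \<in> lists X \<rightarrow> carrier R" and w: "w \<in> lists X"
  shows "conv R (\<lambda>v. r \<otimes> f v) g w = r \<otimes> conv R f g w"
proof -
  note tw = take_drop_lists[OF w]
  have "conv R (\<lambda>v. r \<otimes> f v) g w = (\<Oplus>i\<in>{..length w}. r \<otimes> (f (take i w) \<otimes> g (drop i w)))"
    unfolding conv_def using r f g tw
    by (intro finsum_cong') (auto simp: Pi_iff intro!: m_assoc)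
  also have "\<dots> = r \<otimes> conv R f g w"
    unfolding conv_def using r f g tw by (intro finsum_rdistr[symmetric]) (auto simp: Pi_iff)
  finally show ?thesis .
qed

text \<open>Peeling off the first letter avoids reindexing a sum over pairs of cut points. The
  recursive call has \<open>f\<close> replaced by its left shift, which is why \<open>f\<close> is
  generalised in the induction.\<close>

lemma conv_assoc:
  assumes "f \<in> lists X \<rightarrow> carrier R" "g \<in> lists X \<rightarrow> carrier R" "h \<in> lists X \<rightarrow> carrier R"
    and "w \<in> lists X"
  shows "conv R (conv R f g) h w = conv R f (conv R g h) w"
  using assms
proof (induction w arbitrary: f g)
  case Nil
  have "conv R f g \<in> lists X \<rightarrow> carrier R" "conv R g h \<in> lists X \<rightarrow> carrier R"
    using Nil by (simp_all add: conv_funcset)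
  then have "conv R (conv R f g) h [] = conv R f g [] \<otimes> h []"
      "conv R f (conv R g h) [] = f [] \<otimes> conv R g h []"
    using Nil by (simp_all add: conv_Nil[where X = X])
  moreover have "conv R f g [] = f [] \<otimes> g []" "conv R g h [] = g [] \<otimes> h []"
    using Nil by (simp_all add: conv_Nil[where X = X])
  ultimately show ?case
    using Nil by (simp add: m_assoc Pi_iff)
next
  case (Cons x w)
  then have x: "x \<in> X" and w: "w \<in> lists X" by auto
  have cl: "f [] \<in> carrier R" "g [] \<in> carrier R" "h (x # w) \<in> carrier R"
    using Cons.prems by (auto simp: Pi_iff)
  have fg: "conv R f g \<in> lists X \<rightarrow> carrier R" and gh: "conv R g h \<in> lists X \<rightarrow> carrier R"
    using Cons.prems by (simp_all add: conv_funcset)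
  have fx: "(\<lambda>v. f (x # v)) \<in> lists X \<rightarrow> carrier R" and gx: "(\<lambda>v. g (x # v)) \<in> lists X \<rightarrow> carrier R"
    using Cons.prems x by (auto simp: Pi_iff)
  have fgx: "(\<lambda>v. f [] \<otimes> g (x # v)) \<in> lists X \<rightarrow> carrier R"
    using gx cl by auto
  have fxg: "conv R (\<lambda>v. f (x # v)) g \<in> lists X \<rightarrow> carrier R"
    by (rule conv_funcset[OF fx Cons.prems(2)])
  have gxh: "conv R (\<lambda>v. g (x # v)) h w \<in> carrier R"
    and fgh: "conv R (\<lambda>v. f (x # v)) (conv R g h) w \<in> carrier R"
    using conv_closed[OF gx Cons.prems(3) w] conv_closed[OF fx gh w] .
  \<comment> \<open>Read as a formula for the left shift of a product, \<open>conv_Cons\<close> is a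
    derivation rule twisted by the constant coefficient \<open>f []\<close>. Linearity in the left
    factor then separates the two terms, and the induction hypothesis applies to the second.\<close>
  have "conv R (\<lambda>v. conv R f g (x # v)) h w =
      conv R (\<lambda>v. f [] \<otimes> g (x # v) \<oplus> conv R (\<lambda>v. f (x # v)) g v) h w"
  proof (rule conv_cong[OF _ Cons.prems(3) w])
    show "(\<lambda>v. f [] \<otimes> g (x # v) \<oplus> conv R (\<lambda>v. f (x # v)) g v) \<in> lists X \<rightarrow> carrier R"
      using fgx fxg by (simp add: Pi_iff)
  qed (simp_all add: conv_Cons[OF Cons.prems(1,2) x])
  also have "\<dots> = f [] \<otimes> conv R (\<lambda>v. g (x # v)) h w \<oplus> conv R (conv R (\<lambda>v. f (x # v)) g) h w"
    using conv_add_left[OF fgx fxg Cons.prems(3) w] conv_smult_left[OF cl(1) gx Cons.prems(3) w]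
    by simp
  also have "conv R (conv R (\<lambda>v. f (x # v)) g) h w = conv R (\<lambda>v. f (x # v)) (conv R g h) w"
    by (rule Cons.IH[OF fx Cons.prems(2,3) w])
  finally have *: "conv R (\<lambda>v. conv R f g (x # v)) h w =
      f [] \<otimes> conv R (\<lambda>v. g (x # v)) h w \<oplus> conv R (\<lambda>v. f (x # v)) (conv R g h) w" .
  have "conv R (conv R f g) h (x # w) =
      f [] \<otimes> g [] \<otimes> h (x # w) \<oplus>
      (f [] \<otimes> conv R (\<lambda>v. g (x # v)) h w \<oplus> conv R (\<lambda>v. f (x # v)) (conv R g h) w)"
    using conv_Cons[OF fg Cons.prems(3) x w] conv_Nil[OF Cons.prems(1,2)] * by simp
  \<comment> \<open>The two terms with the factor \<open>f []\<close> combine to \<open>f []\<close>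
    times the coefficient of \<open>conv R g h\<close> at \<open>x # w\<close>.\<close>
  also have "\<dots> = f [] \<otimes> (g [] \<otimes> h (x # w) \<oplus> conv R (\<lambda>v. g (x # v)) h w) \<oplus>
      conv R (\<lambda>v. f (x # v)) (conv R g h) w"
    using cl gxh fgh by (simp add: r_distr m_assoc a_assoc)
  also have "\<dots> = conv R f (conv R g h) (x # w)"
    using conv_Cons[OF Cons.prems(1) gh x w] conv_Cons[OF Cons.prems(2,3) x w] by simp
  finally show ?case .
qed

text \<open>The zero function is \<open>\<zero>\<close> times itself, so this is homogeneity in the
  left factor.\<close>

lemma conv_zero_left:
  assumes "f \<in> lists X \<rightarrow> carrier R" "w \<in> lists X"
  shows "conv R (\<lambda>v. \<zero>) f w = \<zero>"
  using conv_smult_left[of \<zero> "\<lambda>v. \<zero>" X f w] conv_closed[of "\<lambda>v. \<zero>" X f w] assms by simp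

lemma conv_one_left:
  assumes f: "f \<in> lists X \<rightarrow> carrier R" and w: "w \<in> lists X"
  shows "conv R (free_gen R (lists X) []) f w = f w"
proof -
  have e: "free_gen R (lists X) [] \<in> lists X \<rightarrow> carrier R"
    by (auto simp: free_gen_def)
  show ?thesis
  proof (cases w)
    case Nil
    then show ?thesis using conv_Nil[OF e f] f w by (simp add: free_gen_def Pi_iff)
  next
    case (Cons x v)
    then have xv: "x \<in> X" "v \<in> lists X" using w by auto
    have "conv R (\<lambda>v. free_gen R (lists X) [] (x # v)) f v = conv R (\<lambda>v. \<zero>) f v"
      using f xv by (intro conv_cong[where X = X]) (auto simp: free_gen_def)
    also have "\<dots> = \<zero>" by (rule conv_zero_left[OF f xv(2)])
    moreover have "free_gen R (lists X) [] [] = \<one>"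
      by (simp add: free_gen_def)
    moreover have "f w \<in> carrier R"
      using f w by auto
    ultimately show ?thesis
      using conv_Cons[OF e f xv] Cons by simp
  qed
qed

text \<open>Unlike for the left unit, a case distinction on the word does not suffice:
  \<open>conv_Cons\<close> shifts only the left factor, which is now the arbitrary \<open>f\<close>.
  Hence an induction with \<open>f\<close> generalised.\<close>

lemma conv_one_right:
  assumes "f \<in> lists X \<rightarrow> carrier R" and "w \<in> lists X"
  shows "conv R f (free_gen R (lists X) []) w = f w"
  using assms
proof (induction w arbitrary: f)
  have e: "free_gen R (lists X) [] \<in> lists X \<rightarrow> carrier R"
    by (auto simp: free_gen_def)
  have e0: "free_gen R (lists X) [] [] = \<one>"
    and e1: "\<And>x v. \<lbrakk>x \<in> X; v \<in> lists X\<rbrakk> \<Longrightarrow> free_gen R (lists X) [] (x # v) = \<zero>"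
    by (auto simp: free_gen_def)
  {
    case Nil
    then show ?case using conv_Nil[OF Nil(1) e] Nil by (auto simp: Pi_iff e0)
  next
    case (Cons x w)
    then have xw: "x \<in> X" "w \<in> lists X" by auto
    have "(\<lambda>v. f (x # v)) \<in> lists X \<rightarrow> carrier R"
      using Cons.prems by auto
    from Cons.IH[OF this xw(2)] show ?case
      using conv_Cons[OF Cons.prems(1) e xw] xw Cons.prems by (auto simp: e1 Pi_iff)
  }
qed

text \<open>A product can be nonzero only at concatenations of a word from the support of
  \<open>f\<close> with one from the support of \<open>g\<close>, and there are finitely many of
  these.\<close>

lemma conv_finite_support:
  assumes f: "f \<in> carrier (free_module R (lists X))" and g: "g \<in> carrier (free_module R (lists X))"
  shows "(\<lambda>w\<in>lists X. conv R f g w) \<in> carrier (free_module R (lists X))"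
proof (rule free_module_memI)
  let ?B = "\<lambda>f. {w \<in> lists X. f w \<noteq> \<zero>}"
  show "finite ((\<lambda>(u, v). u @ v) ` (?B f \<times> ?B g))"
    using f g by (auto simp: free_module_carrier)
  fix w assume w: "w \<in> lists X"
  show "conv R f g w \<in> carrier R"
    using w by (intro conv_closed[where X = X] Pi_I free_module_closed[OF f] free_module_closed[OF g])
  assume nw: "w \<notin> (\<lambda>(u, v). u @ v) ` (?B f \<times> ?B g)"
  have "f (take i w) \<otimes> g (drop i w) = \<zero>" for i
  proof -
    have "take i w \<notin> ?B f \<or> drop i w \<notin> ?B g"
    proof (rule ccontr)
      assume "\<not> ?thesis"
      \<comment> \<open>The two pieces of a cut concatenate to \<open>w\<close> again, so
        \<open>w\<close> itself would lie in the image.\<close>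
      then have "(\<lambda>(u, v). u @ v) (take i w, drop i w) \<in> (\<lambda>(u, v). u @ v) ` (?B f \<times> ?B g)"
        by (intro imageI) blast
      with nw show False by simp
    qed
    then have "f (take i w) = \<zero> \<or> g (drop i w) = \<zero>"
      using take_drop_lists[OF w, of i] by simp
    moreover have "f (take i w) \<in> carrier R" "g (drop i w) \<in> carrier R"
      using take_drop_lists[OF w] f g by (auto intro: free_module_closed)
    ultimately show ?thesis by auto
  qed
  then show "conv R f g w = \<zero>"
    by (simp add: conv_def)
qed

end

lemma free_algebra_simps [simp]:
  "carrier (free_algebra R X) = carrier (free_module R (lists X))"
  "\<zero>\<^bsub>free_algebra R X\<^esub> = (\<lambda>s\<in>lists X. \<zero>\<^bsub>R\<^esub>)"
  "add (free_algebra R X) = add (free_module R (lists X))"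
  "smult (free_algebra R X) = smult (free_module R (lists X))"
  "\<one>\<^bsub>free_algebra R X\<^esub> = free_gen R (lists X) []"
  by (simp_all add: free_algebra_def)

lemma free_algebra_mult [simp]:
  "f \<otimes>\<^bsub>free_algebra R X\<^esub> g = (\<lambda>w\<in>lists X. conv R f g w)"
  by (simp add: free_algebra_def conv_def)

section \<open>Ring and module axioms for the free algebra\<close>

context cring
begin

text \<open>The free algebra arises from the free module by changing only the multiplicative fields,
  so the additive monoids coincide.\<close>

lemma free_algebra_abelian_group: "abelian_group (free_algebra R X)"
proof -
  have "add_monoid (free_algebra R X) = add_monoid (free_module R (lists X))"
    by simp
  then show ?thesis
    using abelian_group.a_comm_group[OF free_module_abelian_group[of "lists X"]]
    by (intro comm_group_abelian_groupI) simp
qed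

lemma free_algebra_ring: "ring (free_algebra R X)"
proof (rule ringI[OF free_algebra_abelian_group])
  have fn: "f \<in> lists X \<rightarrow> carrier R" if "f \<in> carrier (free_module R (lists X))" for f
    using that by (auto simp: free_module_carrier)
  show "monoid (free_algebra R X)"
  proof (rule monoidI; unfold free_algebra_simps free_algebra_mult)
    fix f g h
    assume f: "f \<in> carrier (free_module R (lists X))" and g: "g \<in> carrier (free_module R (lists X))"
      and h: "h \<in> carrier (free_module R (lists X))"
    note f' = fn[OF f] and g' = fn[OF g] and h' = fn[OF h]
    show "(\<lambda>w\<in>lists X. conv R (\<lambda>w\<in>lists X. conv R f g w) h w) =
        (\<lambda>w\<in>lists X. conv R f (\<lambda>w\<in>lists X. conv R g h w) w)"
    proof (rule restrict_ext)
      fix w assume w: "w \<in> lists X"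
      have "conv R (\<lambda>w\<in>lists X. conv R f g w) h w = conv R (conv R f g) h w"
        by (rule conv_cong[OF conv_funcset[OF f' g'] h' w]) simp_all
      also have "\<dots> = conv R f (conv R g h) w"
        by (rule conv_assoc[OF f' g' h' w])
      also have "\<dots> = conv R f (\<lambda>w\<in>lists X. conv R g h w) w"
        by (rule conv_cong[OF f' conv_funcset[OF g' h'] w, symmetric]) simp_all
      finally show "conv R (\<lambda>w\<in>lists X. conv R f g w) h w =
          conv R f (\<lambda>w\<in>lists X. conv R g h w) w" .
    qed
  next
    fix f assume f: "f \<in> carrier (free_module R (lists X))"
    show "(\<lambda>w\<in>lists X. conv R (free_gen R (lists X) []) f w) = f"
      by (rule free_module_eqI[OF conv_finite_support[OF free_gen_closed f] f])
        (simp add: conv_one_left[OF fn[OF f]])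
    show "(\<lambda>w\<in>lists X. conv R f (free_gen R (lists X) []) w) = f"
      by (rule free_module_eqI[OF conv_finite_support[OF f free_gen_closed] f])
        (simp add: conv_one_right[OF fn[OF f]])
  qed (simp_all add: conv_finite_support)
  fix f g h
  assume "f \<in> carrier (free_algebra R X)" "g \<in> carrier (free_algebra R X)"
    "h \<in> carrier (free_algebra R X)"
  then have f: "f \<in> lists X \<rightarrow> carrier R" and g: "g \<in> lists X \<rightarrow> carrier R"
    and h: "h \<in> lists X \<rightarrow> carrier R"
    by (auto simp: free_module_closed)
  let ?s = "\<lambda>w\<in>lists X. f w \<oplus> g w"
  have "conv R ?s h w = conv R (\<lambda>w. f w \<oplus> g w) h w" if "w \<in> lists X" for w
    using f g h that by (intro conv_cong[where X = X]) auto
  then have "conv R ?s h w = conv R f h w \<oplus> conv R g h w" if "w \<in> lists X" for w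
    using conv_add_left[OF f g h that] that by simp
  then show "(f \<oplus>\<^bsub>free_algebra R X\<^esub> g) \<otimes>\<^bsub>free_algebra R X\<^esub> h =
      f \<otimes>\<^bsub>free_algebra R X\<^esub> h \<oplus>\<^bsub>free_algebra R X\<^esub> g \<otimes>\<^bsub>free_algebra R X\<^esub> h"
    unfolding free_algebra_simps free_algebra_mult free_module_simps
    by (intro restrict_ext) simp
  have "conv R h ?s w = conv R h (\<lambda>w. f w \<oplus> g w) w" if "w \<in> lists X" for w
    using f g h that by (intro conv_cong[where X = X]) auto
  then have "conv R h ?s w = conv R h f w \<oplus> conv R h g w" if "w \<in> lists X" for w
    using conv_add_right[OF h f g that] that by simp
  then show "h \<otimes>\<^bsub>free_algebra R X\<^esub> (f \<oplus>\<^bsub>free_algebra R X\<^esub> g) =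
      h \<otimes>\<^bsub>free_algebra R X\<^esub> f \<oplus>\<^bsub>free_algebra R X\<^esub> h \<otimes>\<^bsub>free_algebra R X\<^esub> g"
    unfolding free_algebra_simps free_algebra_mult free_module_simps
    by (intro restrict_ext) simp
qed

lemma free_algebra_module: "module R (free_algebra R X)"
proof -
  interpret M: module R "free_module R (lists X)" by (rule free_module_module)
  show ?thesis
    by (rule moduleI[OF is_cring free_algebra_abelian_group]; unfold free_algebra_simps;
        (rule M.smult_closed M.smult_l_distr M.smult_r_distr M.smult_assoc1 M.smult_one; assumption))
qed

lemma free_algebra_smult_assoc:
  assumes "r \<in> carrier R" "f \<in> carrier (free_algebra R X)" "g \<in> carrier (free_algebra R X)"
  shows "(r \<odot>\<^bsub>free_algebra R X\<^esub> f) \<otimes>\<^bsub>free_algebra R X\<^esub> g =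
    r \<odot>\<^bsub>free_algebra R X\<^esub> (f \<otimes>\<^bsub>free_algebra R X\<^esub> g)"
proof -
  have fg: "f \<in> lists X \<rightarrow> carrier R" "g \<in> lists X \<rightarrow> carrier R"
    using assms by (auto simp: free_module_closed)
  have "conv R (\<lambda>w\<in>lists X. r \<otimes> f w) g w = conv R (\<lambda>w. r \<otimes> f w) g w" if "w \<in> lists X" for w
    using assms(1) fg that by (intro conv_cong[where X = X]) auto
  then have "conv R (\<lambda>w\<in>lists X. r \<otimes> f w) g w = r \<otimes> conv R f g w" if "w \<in> lists X" for w
    using conv_smult_left[OF assms(1) fg that] that by simp
  then show ?thesis
    unfolding free_algebra_simps free_algebra_mult free_module_simps
    by (intro restrict_ext) simp
qed

end

section \<open>The exterior algebra\<close>

text \<open>The quotient step in the construction of the exterior algebra, isolated for arbitrary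
  \<open>T\<close> and \<open>J\<close> so that its axioms can be proved without looking at the
  relations.\<close>

definition quotient_algebra :: "('r, 'a) module \<Rightarrow> 'a set \<Rightarrow> ('r, 'a set) module" where
  "quotient_algebra T J = ring.extend (T Quot J) (module.fields (\<lambda>r C. \<Union>c\<in>C. J +>\<^bsub>T\<^esub> (r \<odot>\<^bsub>T\<^esub> c)))"

lemma quotient_algebra_simps:
  "carrier (quotient_algebra T J) = a_rcosets\<^bsub>T\<^esub> J"
  "\<zero>\<^bsub>quotient_algebra T J\<^esub> = J"
  "\<one>\<^bsub>quotient_algebra T J\<^esub> = J +>\<^bsub>T\<^esub> \<one>\<^bsub>T\<^esub>"
  "add (quotient_algebra T J) = set_add T"
  "monoid.mult (quotient_algebra T J) = rcoset_mult T J"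
  "smult (quotient_algebra T J) = (\<lambda>r C. \<Union>c\<in>C. J +>\<^bsub>T\<^esub> (r \<odot>\<^bsub>T\<^esub> c))"
  by (simp_all add: quotient_algebra_def ring.defs module.defs FactRing_def)

locale module_ideal = module R T + ideal J T
  for R (structure) and T :: "('r, 'a) module" and J +
  assumes smult_mult: "\<lbrakk>r \<in> carrier R; f \<in> carrier T; g \<in> carrier T\<rbrakk> \<Longrightarrow>
    (r \<odot>\<^bsub>T\<^esub> f) \<otimes>\<^bsub>T\<^esub> g = r \<odot>\<^bsub>T\<^esub> (f \<otimes>\<^bsub>T\<^esub> g)"
begin

text \<open>Scalar multiplication by \<open>r\<close> is left multiplication by the element
  \<open>r\<close> times one of \<open>T\<close>, and the ideal absorbs such products.\<close>

lemma smult_J_closed: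
  assumes "r \<in> carrier R" "a \<in> J"
  shows "r \<odot>\<^bsub>T\<^esub> a \<in> J"
proof -
  have a: "a \<in> carrier T" using assms(2) by (rule a_Hcarr)
  have "r \<odot>\<^bsub>T\<^esub> a = (r \<odot>\<^bsub>T\<^esub> \<one>\<^bsub>T\<^esub>) \<otimes>\<^bsub>T\<^esub> a"
    using assms(1) a by (simp add: smult_mult)
  then show ?thesis
    using assms by (simp add: I_l_closed)
qed

text \<open>Scalars act on a coset through a union over all representatives. Two representatives
  differ by an element of \<open>J\<close>, and so do their multiples by
  \<open>smult_J_closed\<close>; all members of the union are therefore the same coset.\<close>

lemma quotient_smult:
  assumes r: "r \<in> carrier R" and c: "c \<in> carrier T"
  shows "r \<odot>\<^bsub>quotient_algebra T J\<^esub> (J +>\<^bsub>T\<^esub> c) = J +>\<^bsub>T\<^esub> (r \<odot>\<^bsub>T\<^esub> c)"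
proof -
  have const: "J +>\<^bsub>T\<^esub> (r \<odot>\<^bsub>T\<^esub> d) = J +>\<^bsub>T\<^esub> (r \<odot>\<^bsub>T\<^esub> c)" if d: "d \<in> J +>\<^bsub>T\<^esub> c" for d
  proof -
    obtain a where a: "a \<in> J" "d = a \<oplus>\<^bsub>T\<^esub> c"
      using d by (auto simp: a_r_coset_def')
    have "r \<odot>\<^bsub>T\<^esub> d = r \<odot>\<^bsub>T\<^esub> a \<oplus>\<^bsub>T\<^esub> r \<odot>\<^bsub>T\<^esub> c"
      using a r c by (simp add: smult_r_distr a_Hcarr)
    then have "r \<odot>\<^bsub>T\<^esub> d \<in> J +>\<^bsub>T\<^esub> (r \<odot>\<^bsub>T\<^esub> c)"
      using smult_J_closed[OF r a(1)] by (auto simp: a_r_coset_def')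
    then show ?thesis
      using r c by (intro a_repr_independence'[symmetric]) auto
  qed
  \<comment> \<open>The union of a constant family has that constant value only over a nonempty
    index set.\<close>
  have "c \<in> J +>\<^bsub>T\<^esub> c"
    using c by (rule a_rcos_self)
  then have "(\<Union>d\<in>J +>\<^bsub>T\<^esub> c. J +>\<^bsub>T\<^esub> (r \<odot>\<^bsub>T\<^esub> d)) = J +>\<^bsub>T\<^esub> (r \<odot>\<^bsub>T\<^esub> c)"
    by (rule UN_constant_eq) (intro ballI const)
  then show ?thesis
    by (simp only: quotient_algebra_simps)
qed

text \<open>\<open>ring.extend\<close> yields a record of another type than \<open>T Quot J\<close>.
  The ring fields agree, so each axiom is transferred through the field equations.\<close>

lemma quotient_ring: "ring (quotient_algebra T J)"
proof -
  interpret Q: ring "T Quot J" by (rule quotient_is_ring)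
  have eq: "carrier (quotient_algebra T J) = carrier (T Quot J)"
    "add (quotient_algebra T J) = add (T Quot J)"
    "monoid.mult (quotient_algebra T J) = monoid.mult (T Quot J)"
    "\<zero>\<^bsub>quotient_algebra T J\<^esub> = \<zero>\<^bsub>T Quot J\<^esub>"
    "\<one>\<^bsub>quotient_algebra T J\<^esub> = \<one>\<^bsub>T Quot J\<^esub>"
    by (simp_all add: quotient_algebra_simps FactRing_def)
  show ?thesis
    by (rule ringI[OF abelian_groupI monoidI]; unfold eq;
        (rule Q.a_closed Q.zero_closed Q.a_assoc Q.a_comm Q.l_zero Q.add.l_inv_ex Q.m_closed
          Q.one_closed Q.m_assoc Q.l_one Q.r_one Q.l_distr Q.r_distr; assumption))
qed

lemma quotient_carrierE:
  assumes "C \<in> carrier (quotient_algebra T J)"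
  obtains c where "c \<in> carrier T" "C = J +>\<^bsub>T\<^esub> c"
  using assms by (auto simp: A_RCOSETS_def' quotient_algebra_simps)

lemma coset_closed: "c \<in> carrier T \<Longrightarrow> J +>\<^bsub>T\<^esub> c \<in> carrier (quotient_algebra T J)"
  by (simp add: quotient_algebra_simps a_rcosetsI[OF a_subset])

lemma quotient_add:
  "\<lbrakk>c \<in> carrier T; d \<in> carrier T\<rbrakk> \<Longrightarrow>
    (J +>\<^bsub>T\<^esub> c) \<oplus>\<^bsub>quotient_algebra T J\<^esub> (J +>\<^bsub>T\<^esub> d) = J +>\<^bsub>T\<^esub> (c \<oplus>\<^bsub>T\<^esub> d)"
  by (simp add: quotient_algebra_simps a_rcos_sum)

lemma quotient_module: "module R (quotient_algebra T J)"
proof (rule moduleI)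
  show "abelian_group (quotient_algebra T J)"
    using quotient_ring by (rule ring.is_abelian_group)
qed (auto elim!: quotient_carrierE intro: R.is_cring
    simp: quotient_smult quotient_add coset_closed smult_l_distr smult_r_distr smult_assoc1)

end

lemma exterior_algebra_eq:
  "exterior_algebra R M = quotient_algebra (free_algebra R (carrier M)) (exterior_ideal R M)"
  by (simp add: exterior_algebra_def quotient_algebra_def Let_def)

section \<open>The ideal of exterior relations\<close>

context module
begin

lemma exterior_relations_subset: "exterior_relations R M \<subseteq> carrier (free_algebra R (carrier M))"
proof -
  interpret T: ring "free_algebra R (carrier M)" by (rule R.free_algebra_ring)
  interpret T: module R "free_algebra R (carrier M)" by (rule R.free_algebra_module)
  let ?v = "free_var R (carrier M)"
  \<comment> \<open>If \<open>x\<close> lies outside \<open>carrier M\<close>, then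
    \<open>?v x\<close> is the zero polynomial, so membership holds for every
    \<open>x\<close>.\<close>
  have v: "?v x \<in> carrier (free_algebra R (carrier M))" for x
    by (simp add: free_var_def)
  show ?thesis
    unfolding exterior_relations_def Let_def
  proof (intro Un_least subsetI; elim CollectE exE conjE; hypsubst)
    fix x y
    show "?v (x \<oplus>\<^bsub>M\<^esub> y) \<ominus>\<^bsub>free_algebra R (carrier M)\<^esub>
        (?v x \<oplus>\<^bsub>free_algebra R (carrier M)\<^esub> ?v y) \<in> carrier (free_algebra R (carrier M))"
      by (intro T.minus_closed T.a_closed v)
    show "?v x \<otimes>\<^bsub>free_algebra R (carrier M)\<^esub> ?v x \<in> carrier (free_algebra R (carrier M))"
      by (intro T.m_closed v)
    fix r assume "r \<in> carrier R"
    then show "?v (r \<odot>\<^bsub>M\<^esub> x) \<ominus>\<^bsub>free_algebra R (carrier M)\<^esub>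
        (r \<odot>\<^bsub>free_algebra R (carrier M)\<^esub> ?v x) \<in> carrier (free_algebra R (carrier M))"
      by (intro T.minus_closed T.smult_closed v)
  qed
qed

lemma module_ideal_exterior_ideal:
  "module_ideal R (free_algebra R (carrier M)) (exterior_ideal R M)"
proof -
  have "ideal (exterior_ideal R M) (free_algebra R (carrier M))"
    unfolding exterior_ideal_def
    by (rule ring.genideal_ideal[OF R.free_algebra_ring exterior_relations_subset])
  then show ?thesis
    by (intro module_ideal.intro module_ideal_axioms.intro R.free_algebra_module
        R.free_algebra_smult_assoc)
qed

lemma exterior_algebra_ring: "ring (exterior_algebra R M)"
  unfolding exterior_algebra_eq
  by (rule module_ideal.quotient_ring[OF module_ideal_exterior_ideal])

lemma exterior_algebra_module: "module R (exterior_algebra R M)"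
  unfolding exterior_algebra_eq
  by (rule module_ideal.quotient_module[OF module_ideal_exterior_ideal])

lemma exterior_incl_closed: "exterior_incl R M x \<in> carrier (exterior_algebra R M)"
  unfolding exterior_algebra_eq exterior_incl_def
  by (rule module_ideal.coset_closed[OF module_ideal_exterior_ideal]) (simp add: free_var_def)

end

section \<open>Labels of boundaries\<close>

context precubical_set
begin

text \<open>The new indices are obtained before \<open>k\<close> is chosen, hence serve both values
  of \<open>k\<close>. For \<open>m < i\<close> the cubical identity applies as stated and lowers
  \<open>i\<close>; otherwise it is read from right to left and raises \<open>m\<close>.\<close>

lemma bnd_bnd_commute:
  assumes z: "z \<in> cubes P (Suc n)" and i: "i \<in> {1..Suc n}" and m: "m \<in> {1..n}" and l: "l \<in> {0, 1}"
  obtains i' m' where "i' \<in> {1..n}" "m' \<in> {1..Suc n}"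
    "\<And>k. k \<in> {0, 1} \<Longrightarrow>
      bnd P n l m (bnd P (Suc n) k i z) = bnd P n k i' (bnd P (Suc n) l m' z)"
proof (cases "m < i")
  case True
  show ?thesis
  proof (rule that)
    show "i - 1 \<in> {1..n}" "m \<in> {1..Suc n}"
      using True i m by auto
    show "bnd P n l m (bnd P (Suc n) k i z) = bnd P n k (i - 1) (bnd P (Suc n) l m z)"
      if "k \<in> {0, 1}" for k
      using bnd_bnd[OF l that _ True _ z] i m by simp
  qed
next
  case False
  show ?thesis
  proof (rule that)
    show "i \<in> {1..n}" "m + 1 \<in> {1..Suc n}"
      using False i m by auto
    show "bnd P n l m (bnd P (Suc n) k i z) = bnd P n k i (bnd P (Suc n) l (m + 1) z)"
      if "k \<in> {0, 1}" for k
      using bnd_bnd[OF that l _ _ _ z, of i "m + 1"] False i m by simp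
  qed
qed

text \<open>The operator in direction \<open>k\<close> is moved outwards past the others one at a
  time; its index and the cube below it change in a way that does not depend on \<open>k\<close>.
  The bound on \<open>is ! p\<close> is the degree of the cubes on which this operator acts, after
  the \<open>length is - p - 1\<close> entries to its right.\<close>

lemma bnds_bnd_commute:
  assumes x: "x \<in> cubes P (Suc n)" and i: "i \<in> {1..Suc n}" and l: "l \<in> {0, 1}"
    and len: "length is \<le> n"
    and "is": "\<And>p. p < length is \<Longrightarrow> is ! p \<in> {1..n + p + 1 - length is}"
  obtains i' z where "i' \<in> {1..Suc n - length is}" "z \<in> cubes P (Suc n - length is)"
    "\<And>k. k \<in> {0, 1} \<Longrightarrow>
      bnds P n l is (bnd P (Suc n) k i x) = bnd P (Suc n - length is) k i' z"
  using len "is"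
proof (induction "is" arbitrary: thesis)
  case Nil
  then show ?case using x i by auto
next
  case (Cons m "is")
  let ?n = "n - length is"
  have n: "Suc n - length is = Suc ?n" "Suc n - length (m # is) = ?n"
    using Cons.prems(2) by auto
  have "is ! p \<in> {1..n + p + 1 - length is}" if "p < length is" for p
    using Cons.prems(3)[of "Suc p"] that by simp
  then obtain i' z where iz: "i' \<in> {1..Suc n - length is}" "z \<in> cubes P (Suc n - length is)"
    "\<And>k. k \<in> {0, 1} \<Longrightarrow>
      bnds P n l is (bnd P (Suc n) k i x) = bnd P (Suc n - length is) k i' z"
    using Cons.prems(2) by (elim Cons.IH[rotated 2]) auto
  have m: "m \<in> {1..?n}"
    using Cons.prems(2) Cons.prems(3)[of 0] by simp
  \<comment> \<open>The outermost operator is exchanged with the one in direction \<open>k\<close>,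
    so the new cube is the \<open>m'\<close>-th face of \<open>z\<close>.\<close>
  obtain i'' m' where *: "i'' \<in> {1..?n}" "m' \<in> {1..Suc ?n}"
    "\<And>k. k \<in> {0, 1} \<Longrightarrow>
      bnd P ?n l m (bnd P (Suc ?n) k i' z) = bnd P ?n k i'' (bnd P (Suc ?n) l m' z)"
    by (rule bnd_bnd_commute[OF iz(2,1)[unfolded n] m l]) (rule that, assumption, assumption, simp)
  have "bnd P (Suc ?n) l m' z \<in> cubes P ?n"
    using bnd_closed[of "Suc ?n" l m' z] iz(2) * l unfolding n by simp
  then show ?case
    using * iz(3)[unfolded n] by (intro Cons.prems(1)[unfolded n]) simp_all
qed

end

text \<open>For \<open>n = 1\<close> the index list is empty and \<open>bnds\<close> returns
  \<open>x\<close>, so both branches of \<open>edge\<close> agree.\<close>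

lemma edge_eq_bnds: "i \<in> {1..n} \<Longrightarrow> edge P n k i x = bnds P n (1 - k) ([1..<i] @ [i + 1..<n + 1]) x"
  by (auto simp: edge_def)

text \<open>The bound on entry \<open>p\<close> evaluates to \<open>p + 2\<close>. The entry is
  \<open>p + 1\<close> before the gap at \<open>j\<close> and \<open>p + 2\<close> after it.\<close>

lemma edge_indices:
  assumes "j \<in> {1..n}"
  defines "is \<equiv> [1..<j] @ [j + 1..<n + 1]"
  shows "length is = n - 1" "p < length is \<Longrightarrow> is ! p \<in> {1..n + p + 1 - length is}"
  using assms by (auto simp: nth_append)

context hda
begin

lemma label_edge_bnd:
  assumes x: "x \<in> cubes A (Suc n)" and i: "i \<in> {1..Suc n}" and j: "j \<in> {1..n}"
  shows "label A (edge A n 0 j (bnd A (Suc n) 0 i x)) = label A (edge A n 0 j (bnd A (Suc n) 1 i x))"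
proof -
  let ?is = "[1..<j] @ [j + 1..<n + 1]"
  \<comment> \<open>Passing to the edge uses \<open>n - 1\<close> operators, so pulling the face
    operator out of it leaves a cube of degree 2, where \<open>label_bnd\<close> applies.\<close>
  have 2: "Suc n - length ?is = 2"
    using j edge_indices(1)[OF j] by auto
  have "length ?is \<le> n"
    by (simp only: edge_indices(1)[OF j] diff_le_self)
  with edge_indices(2)[OF j] obtain i' z where z: "i' \<in> {1..2}" "z \<in> cubes A 2"
    "\<And>k. k \<in> {0, 1} \<Longrightarrow> bnds A n 1 ?is (bnd A (Suc n) k i x) = bnd A 2 k i' z"
    \<comment> \<open>The direction \<open>1\<close> is the \<open>1 - k\<close> in the definition
      of \<open>edge\<close> for \<open>k = 0\<close>.\<close>
    using bnds_bnd_commute[OF x i, of 1 ?is] unfolding 2 by blast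
  have "i' \<in> {1, 2}" using z(1) by auto
  then show ?thesis
    using label_bnd[OF z(2), of i'] z(3) by (simp add: edge_eq_bnds[OF j] del: upt_Suc)
qed

end

text \<open>Edge labels determine both the summands and, through the word lengths, the set of index
  tuples. For \<open>n = 0\<close> the value is one on every vertex.\<close>

lemma labeling_value_bnd:
  assumes "hda M A" and x: "x \<in> cubes A (Suc n)" and i: "i \<in> {1..Suc n}"
  shows "labeling_value R S A n (bnd A (Suc n) 0 i x) = labeling_value R S A n (bnd A (Suc n) 1 i x)"
proof -
  interpret hda M A by fact
  have w: "label A (edge A n 0 j (bnd A (Suc n) 0 i x)) = label A (edge A n 0 j (bnd A (Suc n) 1 i x))"
    if "j \<in> {1..n}" for j
    using label_edge_bnd[OF x i that] .
  have "(\<Pi>\<^sub>E j\<in>{1..n}. {1..length (label A (edge A n 0 j (bnd A (Suc n) 0 i x)))}) =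
      (\<Pi>\<^sub>E j\<in>{1..n}. {1..length (label A (edge A n 0 j (bnd A (Suc n) 1 i x)))})"
    by (rule PiE_cong) (simp add: w)
  moreover have "map (\<lambda>j. letter R S (label A (edge A n 0 j (bnd A (Suc n) 0 i x)) ! (p j - 1))) [1..<n + 1] =
      map (\<lambda>j. letter R S (label A (edge A n 0 j (bnd A (Suc n) 1 i x)) ! (p j - 1))) [1..<n + 1]" for p
    by (rule map_cong) (simp_all add: w del: One_nat_def upt_Suc)
  ultimately show ?thesis
    unfolding labeling_value_def Let_def by (simp only:)
qed

section \<open>Labeling values as elements of the exterior algebra\<close>

context cring
begin

lemma alphabet_algebra_ring: "ring (alphabet_algebra R S)"
  unfolding alphabet_algebra_def by (rule module.exterior_algebra_ring[OF free_module_module])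

lemma alphabet_algebra_module: "module R (alphabet_algebra R S)"
  unfolding alphabet_algebra_def by (rule module.exterior_algebra_module[OF free_module_module])

lemma letter_closed: "letter R S a \<in> carrier (alphabet_algebra R S)"
  unfolding alphabet_algebra_def letter_def
  by (rule module.exterior_incl_closed[OF free_module_module])

lemma labeling_value_closed: "labeling_value R S A n x \<in> carrier (alphabet_algebra R S)"
proof -
  interpret L: ring "alphabet_algebra R S" by (rule alphabet_algebra_ring)
  have "foldr (\<otimes>\<^bsub>alphabet_algebra R S\<^esub>) (map (\<lambda>i. letter R S (f i)) is) \<one>\<^bsub>alphabet_algebra R S\<^esub>
      \<in> carrier (alphabet_algebra R S)" for f and "is" :: "nat list"
    by (induction "is") (auto intro: letter_closed)
  then show ?thesis
    unfolding labeling_value_def Let_def by (auto intro!: L.finsum_closed simp del: upt_Suc)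
qed

end

section \<open>The cocycle condition\<close>

theorem proposition4p4p4:
  fixes R :: "('r, 'm) ring_scheme" and S :: "'s set"
    and A :: "('p, 's list) hda" and n :: nat
  assumes "principal_domain R"
    and "hda (free_monoid S) A"
  shows "labeling_cochain R S A n \<in> cocycles R A (alphabet_algebra R S) n"
proof -
  interpret principal_domain R by fact
  interpret hda "free_monoid S" A by fact
  let ?L = "alphabet_algebra R S" and ?C = "cubical_chains R A" and ?l = "labeling_cochain R S A n"
  let ?b = "free_gen R (cubes A n)"
  have l: "labeling_value R S A n \<in> cubes A n \<rightarrow> carrier ?L"
    by (simp add: labeling_value_closed)
  have C: "?C m = free_module R (cubes A m)" for m
    by (simp add: cubical_chains_def)
  interpret L: module R ?L by (rule alphabet_algebra_module)
  interpret C: module R "?C n" unfolding C by (rule free_module_module)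
  have hom: "?l \<in> carrier (hom_module R (?C n) ?L)"
    unfolding labeling_cochain_def C by (rule L.linear_extension_hom[OF l])
  interpret l: module_morphism R "?C n" ?L ?l
    by unfold_locales (rule hom)
  have b: "?b y \<in> carrier (?C n)" for y
    by (simp add: C)
  have lb: "?l (?b y) = labeling_value R S A n y" if "y \<in> cubes A n" for y
    unfolding labeling_cochain_def using L.linear_extension_free_gen[OF l that] .
  \<comment> \<open>The \<open>i\<close>-th summand of the boundary of the basis chain
    \<open>x\<close>; the cochain will be shown to kill each summand separately.\<close>
  let ?t = "\<lambda>x i. (\<ominus>\<^bsub>R\<^esub> \<one>\<^bsub>R\<^esub>) [^]\<^bsub>R\<^esub> i \<odot>\<^bsub>?C n\<^esub>
    (?b (bnd A (Suc n) 0 i x) \<ominus>\<^bsub>?C n\<^esub> ?b (bnd A (Suc n) 1 i x))"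
  have t: "?t x i \<in> carrier (?C n)" for x i
    by (intro C.smult_closed C.minus_closed b) simp
  have lt: "?l (?t x i) = \<zero>\<^bsub>?L\<^esub>" if "x \<in> cubes A (Suc n)" "i \<in> {1..Suc n}" for x i
  proof -
    \<comment> \<open>Both faces must be known to be \<open>n\<close>-cubes, since \<open>lb\<close>
      evaluates the cochain only on generators indexed by cubes.\<close>
    have "bnd A (Suc n) k i x \<in> cubes A n" if "k \<in> {0, 1}" for k
      using bnd_closed[of "Suc n" k i x] \<open>x \<in> _\<close> \<open>i \<in> _\<close> that by simp
    then have "?l (?b (bnd A (Suc n) 0 i x) \<ominus>\<^bsub>?C n\<^esub> ?b (bnd A (Suc n) 1 i x)) = \<zero>\<^bsub>?L\<^esub>"
      using labeling_value_bnd[OF \<open>hda (free_monoid S) A\<close> that, of R S]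
      by (simp add: l.hom_minus b lb L.M.r_neg a_minus_def[of ?L] labeling_value_closed)
    then show ?thesis
      by (subst l.hom_smult) (auto intro: C.minus_closed b)
  qed
  \<comment> \<open>Vanishing passes from summands to chains in two stages: over the indices
    \<open>i\<close> of a cube, then over the support of \<open>c\<close>.\<close>
  have "?l (cubical_diff R A (Suc n) c) = \<zero>\<^bsub>?L\<^esub>" if "c \<in> carrier (?C (Suc n))" for c
    unfolding cubical_diff_def Let_def diff_Suc_1
    using that t lt unfolding C[of "Suc n"]
    by (intro l.hom_linear_extension_eq_zero l.hom_finsum_eq_zero C.M.finsum_closed) auto
  \<comment> \<open>Both sides are restricted to the chains of degree \<open>n + 1\<close>, so
    agreement there gives equality of functions.\<close>
  then have "coboundary R A n ?l = \<zero>\<^bsub>cochains R A ?L (n + 1)\<^esub>"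
    by (auto simp: coboundary_def cochains_def hom_module_def intro: restrict_ext)
  then show ?thesis
    using hom by (simp add: cocycles_def cochains_def)
qed

end
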